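(* Let $\mathcal{H}$ be a complex Hilbert space, let $\alpha,\beta$ be real numbers with $0\leq\alpha\leq 1\leq\beta$, let $T\in B(\mathcal{H})$ be an $(\alpha,\beta)$-normal operator, and let $\lambda\in\mathbb{C}$. Then $$\alpha\,\|T\|^{2}\leq w(T^{2})+\frac{2\beta\,\|T-\lambda T^{*}\|^{2}}{(1+|\lambda|\alpha)^{2}}.$$
   Context: $B(\mathcal{H})$ denotes the algebra of bounded linear operators on the complex Hilbert space $(\mathcal{H};\langle\cdot,\cdot\rangle)$, and $\|\cdot\|$ denotes the operator norm. For real numbers $0\leq\alpha\leq 1\leq\beta$, an operator $T\in B(\mathcal{H})$ is called $(\alpha,\beta)$-normal if $\alpha^{2}T^{*}T\leq TT^{*}\leq\beta^{2}T^{*}T$ in the usual (Loewner) order of self-adjoint operators. The numerical radius of $T\in B(\mathcal{H})$ is $w(T)=\sup\{|\langle Tx,x\rangle| : x\in\mathcal{H},\ \|x\|=1\}$. *)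

theory Defs
  imports "HOL-Analysis.Analysis"
begin

text \<open>
  Complex inner product spaces; the inner product is linear in its first argument.
  The real scalar multiplication, norm, metric and topology come from
  \<^class>\<open>real_normed_vector\<close> and are tied to the complex structure by the
  axioms \<open>scaleR_scaleC\<close> and \<open>norm_eq_sqrt_cinner\<close>.
\<close>

class complex_inner = real_normed_vector +
  fixes scaleC :: "complex \<Rightarrow> 'a \<Rightarrow> 'a"  (infixr \<open>*\<^sub>C\<close> 75)
    and cinner :: "'a \<Rightarrow> 'a \<Rightarrow> complex"
  assumes scaleC_add_right: "a *\<^sub>C (x + y) = a *\<^sub>C x + a *\<^sub>C y"
    and scaleC_add_left: "(a + b) *\<^sub>C x = a *\<^sub>C x + b *\<^sub>C x"
    and scaleC_scaleC: "a *\<^sub>C (b *\<^sub>C x) = (a * b) *\<^sub>C x"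
    and scaleC_one: "1 *\<^sub>C x = x"
    and scaleR_scaleC: "r *\<^sub>R x = complex_of_real r *\<^sub>C x"
    and cinner_commute: "cinner x y = cnj (cinner y x)"
    and cinner_add_left: "cinner (x + y) z = cinner x z + cinner y z"
    and cinner_scaleC_left: "cinner (a *\<^sub>C x) y = a * cinner x y"
    and cinner_self_nonneg: "cinner x x \<in> \<real>\<^sub>\<ge>\<^sub>0"
    and cinner_eq_zero_iff: "cinner x x = 0 \<longleftrightarrow> x = 0"
    and norm_eq_sqrt_cinner: "norm x = sqrt (Re (cinner x x))"

class chilbert_space = complex_inner + complete_space

instantiation complex :: chilbert_space
begin

definition scaleC_complex :: "complex \<Rightarrow> complex \<Rightarrow> complex"
  where "scaleC_complex a x = a * x"

definition cinner_complex :: "complex \<Rightarrow> complex \<Rightarrow> complex"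
  where "cinner_complex x y = x * cnj y"

instance
  by standard
    (auto simp: scaleC_complex_def cinner_complex_def algebra_simps scaleR_conv_of_real
      complex_nonneg_Reals_iff cmod_def power2_eq_square)

end

definition bounded_clinear :: "('a::complex_inner \<Rightarrow> 'a) \<Rightarrow> bool"
  where "bounded_clinear T \<longleftrightarrow> bounded_linear T \<and> (\<forall>c x. T (c *\<^sub>C x) = c *\<^sub>C T x)"

text \<open>
  On a Hilbert space every bounded operator has exactly one adjoint (Riesz), so the
  description below is proper for such operators.
\<close>

definition cadjoint :: "('a::complex_inner \<Rightarrow> 'a) \<Rightarrow> 'a \<Rightarrow> 'a"
  where "cadjoint T = (THE S. \<forall>x y. cinner (T x) y = cinner x (S y))"

definition loewner_le :: "('a::complex_inner \<Rightarrow> 'a) \<Rightarrow> ('a \<Rightarrow> 'a) \<Rightarrow> bool"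
  where "loewner_le A B \<longleftrightarrow> (\<forall>x. cinner (B x - A x) x \<in> \<real>\<^sub>\<ge>\<^sub>0)"

definition ab_normal :: "real \<Rightarrow> real \<Rightarrow> ('a::complex_inner \<Rightarrow> 'a) \<Rightarrow> bool"
  where "ab_normal \<alpha> \<beta> T \<longleftrightarrow>
    loewner_le (\<lambda>x. \<alpha>\<^sup>2 *\<^sub>R cadjoint T (T x)) (\<lambda>x. T (cadjoint T x)) \<and>
    loewner_le (\<lambda>x. T (cadjoint T x)) (\<lambda>x. \<beta>\<^sup>2 *\<^sub>R cadjoint T (T x))"

text \<open>
  The element \<open>0\<close> is inserted so that the supremum is taken in the nonnegative reals:
  it only matters on the zero space, which has no unit vectors and where \<open>Sup {}\<close>
  would be unspecified.
\<close>

definition numerical_radius :: "('a::complex_inner \<Rightarrow> 'a) \<Rightarrow> real"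
  where "numerical_radius T = Sup (insert 0 {cmod (cinner (T x) x) | x. norm x = 1})"

end

theory Submission
  imports Defs
begin

text \<open>
  For vectors \<open>a\<close>, \<open>b\<close> of norms \<open>p\<close>, \<open>q\<close> with \<open>r = Re (cinner a b)\<close>, the identity
  \<open>2 p q (p\<^sup>2 + q\<^sup>2 - 2 r) - (p q - r) (p + q)\<^sup>2 = (p - q)\<^sup>2 (p q + r)\<close> and Cauchy-Schwarz give
  a Dunkl-Williams type bound of \<open>p q - r\<close> by \<open>2 p q (norm (a - b))\<^sup>2 / (p + q)\<^sup>2\<close>.  It is applied
  to \<open>a = T x\<close> and \<open>b = \<mu> T\<^sup>* x\<close>, for which \<open>cinner a b\<close> is \<open>cinner (T (T x)) x\<close> up to the
  factor \<open>cnj \<mu>\<close>; normality enters as \<open>\<alpha> norm (T x) \<le> norm (T\<^sup>* x) \<le> \<beta> norm (T x)\<close>.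
\<close>

section \<open>Complex inner products\<close>

lemma cinner_add_right: "cinner x (y + z) = cinner x y + cinner x z"
  by (metis cinner_commute cinner_add_left complex_cnj_add)

lemma cinner_scaleC_right: "cinner x (a *\<^sub>C y) = cnj a * cinner x y"
  by (metis cinner_commute cinner_scaleC_left complex_cnj_mult)

lemma cinner_scaleR_left: "cinner (r *\<^sub>R x) y = of_real r * cinner x y"
  by (simp add: scaleR_scaleC cinner_scaleC_left)

lemma cinner_scaleR_right: "cinner x (r *\<^sub>R y) = of_real r * cinner x y"
  by (simp add: scaleR_scaleC cinner_scaleC_right)

lemma cinner_minus_left: "cinner (- x) y = - cinner x y"
  using cinner_scaleR_left[of "-1" x y] by simp

lemma cinner_minus_right: "cinner x (- y) = - cinner x y"
  using cinner_scaleR_right[of x "-1" y] by simp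

lemma cinner_diff_left: "cinner (x - y) z = cinner x z - cinner y z"
  using cinner_add_left[of x "- y" z] by (simp add: cinner_minus_left)

lemma cinner_diff_right: "cinner x (y - z) = cinner x y - cinner x z"
  using cinner_add_right[of x y "- z"] by (simp add: cinner_minus_right)

lemma cinner_zero_left [simp]: "cinner 0 x = 0"
  using cinner_diff_left[of x x x] by simp

lemma cinner_zero_right [simp]: "cinner x 0 = 0"
  using cinner_diff_right[of x x x] by simp

lemma cinner_self: "cinner x x = of_real ((norm x)\<^sup>2)"
  using cinner_self_nonneg[of x]
  by (simp add: norm_eq_sqrt_cinner complex_nonneg_Reals_iff complex_eq_iff)

lemma Re_cinner_commute: "Re (cinner y x) = Re (cinner x y)"
  by (metis cinner_commute cnj.sel(1))

lemma power2_norm_add: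
  "(norm (x + y))\<^sup>2 = (norm x)\<^sup>2 + (norm y)\<^sup>2 + 2 * Re (cinner x y)"
proof -
  have "cinner (x + y) (x + y) = cinner x x + cinner y y + (cinner x y + cinner y x)"
    by (simp add: cinner_add_left cinner_add_right)
  from arg_cong[OF this, of Re] show ?thesis
    by (simp add: cinner_self Re_cinner_commute flip: of_real_power)
qed

lemma power2_norm_diff:
  "(norm (x - y))\<^sup>2 = (norm x)\<^sup>2 + (norm y)\<^sup>2 - 2 * Re (cinner x y)"
  using power2_norm_add[of x "- y"] by (simp add: cinner_minus_right)

lemma norm_scaleC: "norm (a *\<^sub>C x) = cmod a * norm x"
proof -
  have "cinner (a *\<^sub>C x) (a *\<^sub>C x) = (a * cnj a) * cinner x x"
    by (simp add: cinner_scaleC_left cinner_scaleC_right)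
  then have "of_real ((norm (a *\<^sub>C x))\<^sup>2) = (of_real ((cmod a * norm x)\<^sup>2) :: complex)"
    by (simp only: cinner_self complex_norm_square[symmetric] power_mult_distrib of_real_mult)
  then show ?thesis
    unfolding of_real_eq_iff by (rule power2_eq_imp_eq) simp_all
qed

lemma Cauchy_Schwarz_cinner: "cmod (cinner x y) \<le> norm x * norm y"
proof (cases "y = 0")
  case False
  \<comment> \<open>The vector \<open>a *\<^sub>C y\<close> is the orthogonal projection of
    \<open>x\<close> onto the line through \<open>y\<close>; the inequality says that the remainder
    \<open>x - a *\<^sub>C y\<close> has nonnegative squared norm.\<close>
  define a where "a = cinner x y / of_real ((norm y)\<^sup>2)"
  have "Re (cinner x (a *\<^sub>C y)) = (cmod (cinner x y))\<^sup>2 / (norm y)\<^sup>2"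
    unfolding a_def cinner_scaleC_right
    by (simp add: cmod_power2) (simp add: power2_eq_square)
  moreover have "(norm (a *\<^sub>C y))\<^sup>2 = (cmod (cinner x y))\<^sup>2 / (norm y)\<^sup>2"
    using False by (simp add: a_def norm_scaleC norm_divide norm_power power_divide power_mult_distrib)
      (simp add: power2_eq_square power4_eq_xxxx)
  ultimately have "0 \<le> (norm x)\<^sup>2 - (cmod (cinner x y))\<^sup>2 / (norm y)\<^sup>2"
    using power2_norm_diff[of x "a *\<^sub>C y"] zero_le_power2[of "norm (x - a *\<^sub>C y)"] by linarith
  then have "(cmod (cinner x y))\<^sup>2 \<le> (norm x * norm y)\<^sup>2"
    using False by (simp add: divide_simps power_mult_distrib)
  then show ?thesis
    by (rule power2_le_imp_le) simp
qed simp

lemma cinner_right_unique: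
  assumes "\<And>x. cinner x y = cinner x z"
  shows "y = z"
  using assms[of "y - z"] cinner_eq_zero_iff[of "y - z"] by (simp add: cinner_diff_right)

lemma Dunkl_Williams_cinner:
  "(norm a * norm b - Re (cinner a b)) * (norm a + norm b)\<^sup>2
    \<le> 2 * norm a * norm b * (norm (a - b))\<^sup>2"
proof -
  have "- Re (cinner a b) \<le> norm a * norm b"
    using Cauchy_Schwarz_cinner[of a b] abs_Re_le_cmod[of "cinner a b"] by linarith
  then have "0 \<le> (norm a - norm b)\<^sup>2 * (norm a * norm b + Re (cinner a b))"
    by simp
  also have "\<dots> = 2 * norm a * norm b * (norm (a - b))\<^sup>2
      - (norm a * norm b - Re (cinner a b)) * (norm a + norm b)\<^sup>2"
    unfolding power2_norm_diff by (simp add: algebra_simps power2_eq_square)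
  finally show ?thesis by simp
qed

section \<open>The Riesz representation and adjoints\<close>

text \<open>
  The representing vector minimizes \<open>(norm x)\<^sup>2 - 2 * Re (f x)\<close>; by the parallelogram law every
  minimizing sequence is Cauchy.
\<close>

lemma Riesz_representation:
  fixes f :: "'a::chilbert_space \<Rightarrow> complex"
  assumes f: "bounded_linear f" and f_scaleC: "\<And>c x. f (c *\<^sub>C x) = c * f x"
  shows "\<exists>y. \<forall>x. f x = cinner x y"
proof -
  interpret f: bounded_linear f by (rule f)
  define \<phi> where "\<phi> x = (norm x)\<^sup>2 - 2 * Re (f x)" for x
  define m where "m = Inf (range \<phi>)"
  obtain K where K: "\<And>x. cmod (f x) \<le> norm x * K"
    using f.bounded by blast
  \<comment> \<open>Complete the square: \<open>\<phi> x\<close> is at least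
    \<open>(norm x)\<^sup>2 - 2 * K * norm x\<close>, which is
    \<open>(norm x - K)\<^sup>2 - K\<^sup>2\<close>.\<close>
  have "- K\<^sup>2 \<le> \<phi> x" for x
    using K[of x] complex_Re_le_cmod[of "f x"] zero_le_power2[of "norm x - K"]
    unfolding \<phi>_def power2_diff by (simp add: mult.assoc)
  then have bdd: "bdd_below (range \<phi>)"
    by (meson bdd_belowI2)
  have m_le: "m \<le> \<phi> x" for x
    unfolding m_def by (rule cInf_lower) (use bdd in auto)
  have "\<exists>x. \<phi> x < m + inverse (real (Suc n))" for n
  proof -
    have "Inf (range \<phi>) < m + inverse (real (Suc n))"
      by (simp add: m_def)
    then show ?thesis
      using bdd by (subst (asm) cInf_less_iff) auto
  qed
  then obtain X where X: "\<And>n. \<phi> (X n) < m + inverse (real (Suc n))"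
    by metis
  \<comment> \<open>The contributions of \<open>f\<close> cancel by additivity, leaving the usual
    parallelogram law. Since the midpoint has value at least \<open>m\<close>, two near-minimizers
    must be close.\<close>
  have parallelogram: "(norm (x - y))\<^sup>2 = 2 * \<phi> x + 2 * \<phi> y - 4 * \<phi> ((1/2) *\<^sub>R (x + y))" for x y
    unfolding \<phi>_def
    by (simp add: power2_norm_diff power2_norm_add f.add f.scaleR cinner_scaleR_left
        cinner_scaleR_right power_mult_distrib field_simps)
  have dist_le: "(norm (x - y))\<^sup>2 \<le> 2 * (\<phi> x - m) + 2 * (\<phi> y - m)" for x y
    unfolding parallelogram using m_le[of "(1/2) *\<^sub>R (x + y)"] by (simp add: algebra_simps)
  have "Cauchy X"
  proof (rule CauchyI)
    fix e :: real
    assume "0 < e"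
    \<comment> \<open>Both excesses over \<open>m\<close> enter \<open>dist_le\<close> with factor
      2, so each may use a quarter of \<open>e\<^sup>2\<close>.\<close>
    then have "0 < e\<^sup>2 / 4" by simp
    then obtain N where N: "inverse (real (Suc N)) < e\<^sup>2 / 4"
      using reals_Archimedean by blast
    have "norm (X i - X j) < e" if "N \<le> i" "N \<le> j" for i j
    proof (rule power2_less_imp_less)
      have "inverse (real (Suc i)) \<le> inverse (real (Suc N))"
        "inverse (real (Suc j)) \<le> inverse (real (Suc N))"
        using that by (auto intro!: le_imp_inverse_le)
      then have "\<phi> (X i) - m < e\<^sup>2 / 4" "\<phi> (X j) - m < e\<^sup>2 / 4"
        using X[of i] X[of j] N by linarith+
      then have "2 * (\<phi> (X i) - m) + 2 * (\<phi> (X j) - m) < e\<^sup>2"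
        by argo
      with dist_le show "(norm (X i - X j))\<^sup>2 < e\<^sup>2"
        by (rule le_less_trans)
    qed (use \<open>0 < e\<close> in simp)
    then show "\<exists>M. \<forall>i\<ge>M. \<forall>j\<ge>M. norm (X i - X j) < e" by blast
  qed
  then obtain y where y: "X \<longlonglongrightarrow> y"
    by (meson Cauchy_convergent convergent_def)
  have "(\<lambda>n. \<phi> (X n)) \<longlonglongrightarrow> \<phi> y"
    unfolding \<phi>_def by (intro tendsto_intros f.tendsto y)
  moreover have "(\<lambda>n. m + inverse (real (Suc n))) \<longlonglongrightarrow> m + 0"
    by (intro tendsto_intros LIMSEQ_inverse_real_of_nat)
  ultimately have "\<phi> y \<le> m"
    using X by (intro LIMSEQ_le[of "\<lambda>n. \<phi> (X n)" _ "\<lambda>n. m + inverse (real (Suc n))"])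
      (auto intro: less_imp_le)
  then have min: "\<phi> y \<le> \<phi> x" for x
    using m_le[of x] by linarith
  have Re_eq: "Re (f h) = Re (cinner h y)" for h
  proof (cases "h = 0")
    case False
    define d where "d = Re (f h) - Re (cinner h y)"
    \<comment> \<open>This \<open>t\<close> minimizes the quadratic
      \<open>\<phi> (y + t *\<^sub>R h)\<close>. The drop below \<open>\<phi> y\<close> would be
      \<open>d\<^sup>2 / (norm h)\<^sup>2\<close>, so minimality of \<open>y\<close> forces
      \<open>d = 0\<close>.\<close>
    define t where "t = d / (norm h)\<^sup>2"
    have "\<phi> (y + t *\<^sub>R h) = \<phi> y + t\<^sup>2 * (norm h)\<^sup>2 - 2 * t * d"
      unfolding \<phi>_def d_def power2_norm_add
      by (simp add: f.add f.scaleR cinner_scaleR_right Re_cinner_commute[of y h]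
          power_mult_distrib algebra_simps)
    also have "\<dots> = \<phi> y - d\<^sup>2 / (norm h)\<^sup>2"
      using False by (simp add: t_def power2_eq_square field_simps)
    finally have "d\<^sup>2 / (norm h)\<^sup>2 \<le> 0"
      using min[of "y + t *\<^sub>R h"] by linarith
    then show ?thesis
      using False by (simp add: d_def divide_le_0_iff)
  qed (simp add: f.zero)
  \<comment> \<open>Real parts at \<open>\<i> *\<^sub>C x\<close> are the negated imaginary parts at
    \<open>x\<close>, by complex linearity.\<close>
  have "f x = cinner x y" for x
    using Re_eq[of x] Re_eq[of "\<i> *\<^sub>C x"]
    by (simp add: f_scaleC cinner_scaleC_left complex_eq_iff)
  then show ?thesis by blast
qed

text \<open>This justifies the definite description in \<open>cadjoint\<close>: Riesz, applied for
  each \<open>y\<close> to the functional sending \<open>x\<close> to \<open>cinner (T x) y\<close>,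
  gives existence, and \<open>cinner_right_unique\<close> gives uniqueness.\<close>

lemma cinner_cadjoint:
  fixes T :: "'a::chilbert_space \<Rightarrow> 'a"
  assumes T: "bounded_clinear T"
  shows "cinner (T x) y = cinner x (cadjoint T y)"
proof -
  interpret T: bounded_linear T
    using T by (simp add: bounded_clinear_def)
  have "\<exists>z. \<forall>x. cinner (T x) y = cinner x z" for y
  proof (rule Riesz_representation)
    obtain K where K: "\<And>x. norm (T x) \<le> norm x * K"
      using T.bounded by blast
    show "bounded_linear (\<lambda>x. cinner (T x) y)"
    proof (rule bounded_linear_intro[where K = "K * norm y"])
      show "cmod (cinner (T x) y) \<le> norm x * (K * norm y)" for x
        using Cauchy_Schwarz_cinner[of "T x" y] mult_right_mono[OF K[of x], of "norm y"]
        by (simp add: mult.assoc)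
    qed (simp_all add: T.add T.scaleR cinner_add_left cinner_scaleR_left scaleR_conv_of_real)
    show "cinner (T (c *\<^sub>C x)) y = c * cinner (T x) y" for c x
      using T by (simp add: bounded_clinear_def cinner_scaleC_left)
  qed
  then obtain S where S: "\<forall>x y. cinner (T x) y = cinner x (S y)"
    by metis
  have "cadjoint T = S"
    unfolding cadjoint_def
  proof (rule the_equality)
    show "\<forall>x y. cinner (T x) y = cinner x (S y)" by (rule S)
    show "R = S" if "\<forall>x y. cinner (T x) y = cinner x (R y)" for R
      by (rule ext, rule cinner_right_unique) (metis that S)
  qed
  then show ?thesis using S by metis
qed

lemma bounded_linear_cadjoint:
  fixes T :: "'a::chilbert_space \<Rightarrow> 'a"
  assumes T: "bounded_clinear T"
  shows "bounded_linear (cadjoint T)"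
proof -
  interpret T: bounded_linear T
    using T by (simp add: bounded_clinear_def)
  note adj = cinner_cadjoint[OF T, symmetric]
  obtain K where K: "0 \<le> K" "\<And>x. norm (T x) \<le> norm x * K"
    using T.nonneg_bounded by blast
  show ?thesis
  proof (rule bounded_linear_intro[where K = K])
    show "cadjoint T (x + y) = cadjoint T x + cadjoint T y" for x y
      by (rule cinner_right_unique) (simp add: adj cinner_add_right)
    show "cadjoint T (r *\<^sub>R x) = r *\<^sub>R cadjoint T x" for r x
      by (rule cinner_right_unique) (simp add: adj cinner_scaleR_right)
    show "norm (cadjoint T y) \<le> norm y * K" for y
    proof (cases "cadjoint T y = 0")
      case False
      \<comment> \<open>Cauchy-Schwarz at the vector \<open>cadjoint T y\<close> produces one factor
        \<open>norm (cadjoint T y)\<close> on the right, which is then cancelled; the bound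
        \<open>K\<close> of \<open>T\<close> carries over.\<close>
      have "(norm (cadjoint T y))\<^sup>2 = cmod (cinner (T (cadjoint T y)) y)"
        by (simp add: cinner_cadjoint[OF T] cinner_self norm_power)
      also have "\<dots> \<le> norm (T (cadjoint T y)) * norm y"
        by (rule Cauchy_Schwarz_cinner)
      also have "\<dots> \<le> norm (cadjoint T y) * K * norm y"
        by (intro mult_right_mono K) simp
      finally show ?thesis
        using False by (simp add: power2_eq_square mult_ac)
    qed (use K in simp)
  qed
qed

section \<open>Numerical radius and normality\<close>

text \<open>By Cauchy-Schwarz the values on unit vectors are at most \<open>onorm A\<close>, so the
  supremum is taken over a bounded set and dominates each element, including the inserted 0.\<close>

lemma
  fixes A :: "'a::complex_inner \<Rightarrow> 'a"
  assumes A: "bounded_linear A"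
  shows numerical_radius_nonneg: "0 \<le> numerical_radius A"
    and cmod_cinner_le_numerical_radius: "norm x = 1 \<Longrightarrow> cmod (cinner (A x) x) \<le> numerical_radius A"
proof -
  have "cmod (cinner (A x) x) \<le> onorm A" if "norm x = 1" for x
    using Cauchy_Schwarz_cinner[of "A x" x] onorm[OF A, of x] that by simp
  then have bdd: "bdd_above (insert 0 {cmod (cinner (A x) x) | x. norm x = 1})"
    by (auto intro!: bdd_aboveI[where M = "onorm A"])
  show "0 \<le> numerical_radius A"
    unfolding numerical_radius_def by (rule cSup_upper[OF _ bdd]) simp
  show "cmod (cinner (A x) x) \<le> numerical_radius A" if "norm x = 1"
    unfolding numerical_radius_def by (rule cSup_upper[OF _ bdd]) (use that in auto)
qed

text \<open>Evaluated at \<open>x\<close>, the quadratic forms of \<open>T T\<^sup>*\<close> and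
  \<open>T\<^sup>* T\<close> are the squared norms of \<open>cadjoint T x\<close> and
  \<open>T x\<close>; both bounds follow by taking square roots.\<close>

lemma ab_normal_norm_bounds:
  fixes T :: "'a::chilbert_space \<Rightarrow> 'a"
  assumes "0 \<le> \<beta>" and T: "bounded_clinear T" and normal: "ab_normal \<alpha> \<beta> T"
  shows "\<alpha> * norm (T x) \<le> norm (cadjoint T x)" and "norm (cadjoint T x) \<le> \<beta> * norm (T x)"
proof -
  have TT: "Re (cinner (T (cadjoint T x)) x) = (norm (cadjoint T x))\<^sup>2"
    by (simp add: cinner_cadjoint[OF T] cinner_self flip: of_real_power)
  have "Re (cinner (cadjoint T (T x)) x) = Re (cinner x (cadjoint T (T x)))"
    by (rule Re_cinner_commute)
  also have "\<dots> = (norm (T x))\<^sup>2"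
    by (simp add: cinner_cadjoint[OF T, symmetric] cinner_self flip: of_real_power)
  finally have T'T: "Re (cinner (cadjoint T (T x)) x) = (norm (T x))\<^sup>2" .
  have "0 \<le> Re (cinner (T (cadjoint T x) - \<alpha>\<^sup>2 *\<^sub>R cadjoint T (T x)) x)"
    and "0 \<le> Re (cinner (\<beta>\<^sup>2 *\<^sub>R cadjoint T (T x) - T (cadjoint T x)) x)"
    using normal by (simp_all add: ab_normal_def loewner_le_def complex_nonneg_Reals_iff)
  then have "(\<alpha> * norm (T x))\<^sup>2 \<le> (norm (cadjoint T x))\<^sup>2"
    and "(norm (cadjoint T x))\<^sup>2 \<le> (\<beta> * norm (T x))\<^sup>2"
    by (simp_all add: cinner_diff_left cinner_scaleR_left TT T'T power_mult_distrib
        flip: of_real_power)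
  then show "\<alpha> * norm (T x) \<le> norm (cadjoint T x)" "norm (cadjoint T x) \<le> \<beta> * norm (T x)"
    using assms(1) by (auto intro: power2_le_imp_le)
qed

text \<open>Rescaling to unit vectors turns a pointwise estimate into one for the operator norm. On
  the zero space \<open>unit\<close> is vacuous, and \<open>0 \<le> R\<close> yields the
  claim.\<close>

lemma onorm_power2_bound:
  assumes T: "bounded_linear T" and "0 \<le> a" "0 \<le> R"
    and unit: "\<And>x. norm x = 1 \<Longrightarrow> a * (norm (T x))\<^sup>2 \<le> R"
  shows "a * (onorm T)\<^sup>2 \<le> R"
proof (cases "a = 0")
  case False
  then have "0 < a" using \<open>0 \<le> a\<close> by simp
  interpret T: bounded_linear T by (rule T)
  have "norm (T x) \<le> sqrt (R / a) * norm x" for x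
  proof (cases "x = 0")
    case False
    have "a * (norm (T (x /\<^sub>R norm x)))\<^sup>2 \<le> R"
      by (rule unit) (use False in simp)
    then have "(norm (T (x /\<^sub>R norm x)))\<^sup>2 \<le> R / a"
      using \<open>0 < a\<close> by (simp add: pos_le_divide_eq mult.commute)
    then have "norm (T (x /\<^sub>R norm x)) \<le> sqrt (R / a)"
      by (rule real_le_rsqrt)
    then show ?thesis
      using False by (simp add: T.scaleR divide_simps mult.commute)
  qed (simp add: T.zero)
  then have "onorm T \<le> sqrt (R / a)"
    using \<open>0 < a\<close> \<open>0 \<le> R\<close> by (intro onorm_bound) simp_all
  then have "(onorm T)\<^sup>2 \<le> (sqrt (R / a))\<^sup>2"
    by (intro power_mono onorm_pos_le T)
  then show ?thesis
    using \<open>0 < a\<close> \<open>0 \<le> R\<close> by (simp add: pos_le_divide_eq mult.commute)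
qed (use \<open>0 \<le> R\<close> in simp)

theorem theorem2p3:
  fixes T :: "'a::chilbert_space \<Rightarrow> 'a"
    and \<alpha> \<beta> :: real
    and \<mu> :: complex
  assumes "0 \<le> \<alpha>" and "\<alpha> \<le> 1" and "1 \<le> \<beta>"
    and "bounded_clinear T"
    and "ab_normal \<alpha> \<beta> T"
  shows "\<alpha> * (onorm T)\<^sup>2 \<le> numerical_radius (T \<circ> T) +
    2 * \<beta> * (onorm (\<lambda>x. T x - \<mu> *\<^sub>C cadjoint T x))\<^sup>2 / (1 + cmod \<mu> * \<alpha>)\<^sup>2"
proof -
  have T: "bounded_linear T"
    using assms(4) by (simp add: bounded_clinear_def)
  have TT: "bounded_linear (T \<circ> T)"
    using bounded_linear_compose[OF T T] by (simp add: o_def)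
  have "bounded_linear (\<lambda>x::'a. \<mu> *\<^sub>C x)"
    by (rule bounded_linear_intro[where K = "cmod \<mu>"])
      (simp_all add: scaleC_add_right scaleR_scaleC scaleC_scaleC mult.commute norm_scaleC)
  then have S: "bounded_linear (\<lambda>x. T x - \<mu> *\<^sub>C cadjoint T x)"
    using bounded_linear_sub[OF T bounded_linear_compose[OF _ bounded_linear_cadjoint[OF assms(4)]]]
    by blast
  define w where "w = numerical_radius (T \<circ> T)"
  define D where "D = onorm (\<lambda>x. T x - \<mu> *\<^sub>C cadjoint T x)"
  define c where "c = 1 + cmod \<mu> * \<alpha>"
  have w0: "0 \<le> w"
    unfolding w_def by (rule numerical_radius_nonneg[OF TT])
  have c: "0 < c"
    using assms(1) by (simp add: c_def add_pos_nonneg)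
  have R0: "0 \<le> w + 2 * \<beta> * D\<^sup>2 / c\<^sup>2"
    using w0 assms(3) by simp
  have "\<alpha> * (onorm T)\<^sup>2 \<le> w + 2 * \<beta> * D\<^sup>2 / c\<^sup>2"
  proof (rule onorm_power2_bound[OF T assms(1) R0])
    fix x :: 'a
    assume x: "norm x = 1"
    define p where "p = norm (T x)"
    define s where "s = norm (cadjoint T x)"
    define N where "N = norm (T x - \<mu> *\<^sub>C cadjoint T x)"
    have ND: "N\<^sup>2 \<le> D\<^sup>2"
      using onorm[OF S, of x] x by (intro power_mono) (simp_all add: N_def D_def)
    have s: "\<alpha> * p \<le> s" "s \<le> \<beta> * p"
      unfolding p_def s_def using ab_normal_norm_bounds[OF _ assms(4,5), of x] assms(3)
    by simp_all
    have T2: "cmod (cinner (T x) (cadjoint T x)) \<le> w"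
      using cmod_cinner_le_numerical_radius[OF TT x]
      by (simp add: w_def cinner_cadjoint[OF assms(4)])
    show "\<alpha> * (norm (T x))\<^sup>2 \<le> w + 2 * \<beta> * D\<^sup>2 / c\<^sup>2"
    \<comment> \<open>The general argument cancels \<open>cmod \<mu>\<close> and \<open>p\<close>,
      so their vanishing is treated first. For \<open>\<mu> = 0\<close> one has \<open>N = p\<close>
      and \<open>c = 1\<close>, and \<alpha> \<le> 1 \<le> 2 \<beta> suffices.\<close>
    proof (cases "\<mu> = 0 \<or> p = 0")
      case True
      then show ?thesis
      proof
        assume "\<mu> = 0"
        then have "norm (\<mu> *\<^sub>C cadjoint T x) = 0"
          by (simp only: norm_scaleC) simp
        then have "N = p" "c = 1"
          using \<open>\<mu> = 0\<close> by (simp_all add: N_def p_def c_def)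
        then have "\<alpha> * p\<^sup>2 \<le> 1 * D\<^sup>2"
          using ND assms(1,2) by (intro mult_mono) simp_all
        also have "\<dots> \<le> 2 * \<beta> * D\<^sup>2"
          using assms(3) by (intro mult_right_mono) simp_all
        finally show ?thesis
          using w0 \<open>c = 1\<close> by (simp add: p_def)
      qed (use R0 in \<open>simp add: p_def\<close>)
    next
      case False
      define l where "l = cmod \<mu>"
      have l: "0 < l" and p: "0 < p"
        using False by (auto simp: l_def p_def)
      have s0: "0 \<le> s" by (simp add: s_def)
      have "0 < p + l * s"
        using l p s0 by (simp add: add_pos_nonneg)
      have "Re (cinner (T x) (\<mu> *\<^sub>C cadjoint T x)) \<le> cmod (cnj \<mu> * cinner (T x) (cadjoint T x))"
        unfolding cinner_scaleC_right by (rule complex_Re_le_cmod)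
      also have "\<dots> \<le> l * w"
        using T2 by (simp add: norm_mult l_def mult_left_mono)
      \<comment> \<open>The two vectors have norms \<open>p\<close> and \<open>l * s\<close>.
        Replacing the real part by its upper bound \<open>l * w\<close> only lowers the left side,
        and then a common factor \<open>l\<close> can be cancelled.\<close>
      finally have "(p * (l * s) - l * w) * (p + l * s)\<^sup>2
          \<le> (p * (l * s) - Re (cinner (T x) (\<mu> *\<^sub>C cadjoint T x))) * (p + l * s)\<^sup>2"
        by (intro mult_right_mono) simp_all
      also have "\<dots> \<le> 2 * p * (l * s) * N\<^sup>2"
        using Dunkl_Williams_cinner[of "T x" "\<mu> *\<^sub>C cadjoint T x"]
        by (simp add: p_def s_def l_def N_def norm_scaleC)
      finally have "l * ((p * s - w) * (p + l * s)\<^sup>2) \<le> l * (2 * (p * s) * N\<^sup>2)"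
        by (simp add: algebra_simps)
      then have "(p * s - w) * (p + l * s)\<^sup>2 \<le> 2 * (p * s) * N\<^sup>2"
        using l by simp
      then have "p * s - w \<le> 2 * (p * s) * N\<^sup>2 / (p + l * s)\<^sup>2"
        using \<open>0 < p + l * s\<close> by (simp add: pos_le_divide_eq)
      \<comment> \<open>Both halves of normality are used: \<open>s \<le> \<beta> * p\<close> in the
        numerator, and \<open>\<alpha> * p \<le> s\<close> in the denominator, where it gives
        \<open>p * c \<le> p + l * s\<close>. The factors \<open>p\<^sup>2\<close> then
        cancel.\<close>
      also have "\<dots> \<le> 2 * (p * (\<beta> * p)) * D\<^sup>2 / (p * c)\<^sup>2"
      proof (rule frac_le)
        show "2 * (p * s) * N\<^sup>2 \<le> 2 * (p * (\<beta> * p)) * D\<^sup>2"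
          using s ND p s0 assms(3) by (intro mult_mono) simp_all
        have "l * (\<alpha> * p) \<le> l * s"
          using s l by (intro mult_left_mono) simp_all
        then have "p * c \<le> p + l * s"
          by (simp add: c_def l_def algebra_simps)
        then show "(p * c)\<^sup>2 \<le> (p + l * s)\<^sup>2"
          using p c by (intro power_mono) simp_all
      qed (use p c s0 assms(3) in simp_all)
      also have "\<dots> = 2 * \<beta> * D\<^sup>2 / c\<^sup>2"
        using p c by (simp add: field_simps power2_eq_square)
      finally have "p * s \<le> w + 2 * \<beta> * D\<^sup>2 / c\<^sup>2"
        by simp
      moreover have "\<alpha> * p\<^sup>2 \<le> p * s"
        using mult_left_mono[OF s(1), of p] p by (simp add: power2_eq_square mult_ac)
      ultimately show ?thesis
        by (simp add: p_def)
    qed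
  qed
  then show ?thesis
    by (simp add: w_def D_def c_def)
qed

end
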